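(* Consider the control system $$\Sigma:\quad \dot\eta=f(\eta,\zeta),\qquad \dot\zeta=\upsilon,$$ with state $(\eta,\zeta)\in\mathbb{R}^{n_\eta}\times\mathbb{R}^{n_\zeta}$ and control input $\upsilon$. Suppose there exists a continuously differentiable function $\psi:\mathbb{R}^{n_\eta}\to\mathbb{R}^{n_\zeta}$ such that the smooth function $\widehat V:\mathbb{R}^{n_\eta}\times\mathbb{R}^{n_\eta}\to\mathbb{R}_0^+$ is a $\delta_\exists$-ISS Lyapunov function for the control system $$\Sigma_\eta:\quad \dot\eta=f(\eta,\psi(\eta)+\widetilde\upsilon)$$ with respect to the control input $\widetilde\upsilon$. Assume that $\widehat V$ satisfies the dissipation inequality $$\frac{\partial\widehat V}{\partial y}f(y,\psi(y)+\widetilde u)+\frac{\partial\widehat V}{\partial y'}f(y',\psi(y')+\widetilde u')\le-\kappa\widehat V(y,y')+\sigma(\|\widetilde u-\widetilde u'\|)$$ for all $y,y'\in\mathbb{R}^{n_\eta}$ and all input values $\widetilde u,\widetilde u'$, for some $\kappa\in\mathbb{R}^+$ and some $\sigma\in\mathcal{K}_\infty$ satisfying $\sigma(r)\le\widehat\kappa r^2$ for some $\widehat\kappa\in\mathbb{R}^+$ and all $r\in\mathbb{R}_0^+$. Then the function $\widetilde V:\mathbb{R}^{n_\eta+n_\zeta}\times\mathbb{R}^{n_\eta+n_\zeta}\to\mathbb{R}_0^+$ defined by $$\widetilde V(x,x')=\widehat V(y,y')+\|(z-\psi(y))-(z'-\psi(y'))\|^2,$$ where $x=[y^T,z^T]^T$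 and $x'=[y'^T,z'^T]^T$, is a $\delta_\exists$-ISS Lyapunov function for $\Sigma$ equipped with the state feedback control law $$\upsilon=k(\eta,\zeta,\widehat\upsilon)=-\lambda(\zeta-\psi(\eta))+\frac{\partial\psi}{\partial y}(\eta)f(\eta,\zeta)+\widehat\upsilon$$ (i.e. for the resulting closed-loop system with input $\widehat\upsilon$), for all $\lambda\ge\frac{\kappa+\widehat\kappa+1}{2}$.
   Context: Here $\frac{\partial\psi}{\partial y}$ is the Jacobian of $\psi$; $\|\cdot\|$ is the Euclidean norm; the inputs $\upsilon,\widetilde\upsilon,\widehat\upsilon$ take values in $\mathbb{R}^{n_\zeta}$. Control systems. A control system is a quadruple $(\mathbb{R}^n,\mathsf{U},\mathcal{U},F)$ where $\mathbb{R}^n$ is the state space; $\mathsf{U}\subseteq\mathbb{R}^m$ is the input set; $\mathcal{U}$ is the set of all measurable, locally essentially bounded functions of time from intervals $]a,b[\subseteq\mathbb{R}$, with $a<0<b$, to $\mathsf{U}$; and $F:\mathbb{R}^n\times\mathsf{U}\to\mathbb{R}^n$ is continuous and such that for every compact $Q\subset\mathbb{R}^n$ there is $Z>0$ with $\|F(x,u)-F(y,u)\|\le Z\|x-y\|$ for all $x,y\in Q$, $u\in\mathsf{U}$. Comparison functions. A continuous $\gamma:\mathbb{R}_0^+\to\mathbb{R}_0^+$ is of class $\mathcal{K}_\infty$ if it is strictly increasing, $\gamma(0)=0$, and $\gamma(r)\to\infty$ as $r\to\infty$. $\delta_\exists$-ISS Lyapunov function. For a control system $(\mathbb{R}^n,\mathsf{U},\mathcal{U},F)$,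 a smooth function $V:\mathbb{R}^n\times\mathbb{R}^n\to\mathbb{R}_0^+$ is a $\delta_\exists$-ISS Lyapunov function if there exist a metric $\mathbf{d}$ on $\mathbb{R}^n$, $\underline\alpha,\overline\alpha,\sigma\in\mathcal{K}_\infty$ and $\kappa\in\mathbb{R}^+$ such that (i) $\underline\alpha(\mathbf{d}(x,x'))\le V(x,x')\le\overline\alpha(\mathbf{d}(x,x'))$ for all $x,x'\in\mathbb{R}^n$; (iii) $\frac{\partial V}{\partial x}F(x,u)+\frac{\partial V}{\partial x'}F(x',u')\le-\kappa V(x,x')+\sigma(\|u-u'\|)$ for all $x,x'\in\mathbb{R}^n$, $u,u'\in\mathsf{U}$. A function is smooth if it is infinitely differentiable.
   Formalization: For merely continuously differentiable ψ, Ṽ need not be smooth (e.g. ψ(y)=y|y|), so it is shown C¹, nonnegative and satisfying (i) and (iii); that Ṽ is a (smooth) δ∃-ISS Lyapunov function, and the closed loop a control system, is stated for smooth ψ. *)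

theory Defs
  imports "HOL-Analysis.Analysis"
begin

text \<open>Continuous differentiability of order \<open>k\<close> on a whole Euclidean space. In finite dimension it
  is enough that all directional derivatives, in every fixed direction \<open>v\<close>, are of class \<open>C^(k-1)\<close>.\<close>

primrec class_C :: "nat \<Rightarrow> ('a::euclidean_space \<Rightarrow> 'b::euclidean_space) \<Rightarrow> bool" where
  "class_C 0 g \<longleftrightarrow> continuous_on UNIV g"
| "class_C (Suc k) g \<longleftrightarrow>
     (\<forall>x. g differentiable (at x)) \<and> (\<forall>v. class_C k (\<lambda>x. frechet_derivative g (at x) v))"

definition smooth :: "('a::euclidean_space \<Rightarrow> 'b::euclidean_space) \<Rightarrow> bool" where
  "smooth g \<longleftrightarrow> (\<forall>k. class_C k g)"

text \<open>Elements of \<open>\<K>\<^sub>\<infinity>\<close> are functions on the nonnegative reals; their values at negative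
  arguments are irrelevant.\<close>

definition K_infinity :: "(real \<Rightarrow> real) \<Rightarrow> bool" where
  "K_infinity \<gamma> \<longleftrightarrow>
     continuous_on {0..} \<gamma> \<and> strict_mono_on {0..} \<gamma> \<and> \<gamma> 0 = 0 \<and> filterlim \<gamma> at_top at_top"

text \<open>A control system is given by its input set \<open>U\<close> and its vector field \<open>F\<close>: the state space is the
  type, and the class of input signals (measurable, locally essentially bounded, with values in
  \<open>U\<close>) is determined by \<open>U\<close>. The Lipschitz constant is uniform in the input value.\<close>

definition control_system ::
  "'u::euclidean_space set \<Rightarrow> ('x::euclidean_space \<Rightarrow> 'u \<Rightarrow> 'x) \<Rightarrow> bool" where
  "control_system U F \<longleftrightarrow>
     continuous_on (UNIV \<times> U) (\<lambda>(x, u). F x u) \<and>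
     (\<forall>Q. compact Q \<longrightarrow>
        (\<exists>Z>0. \<forall>x\<in>Q. \<forall>y\<in>Q. \<forall>u\<in>U. norm (F x u - F y u) \<le> Z * norm (x - y)))"

text \<open>The left-hand side is \<open>(\<partial>V/\<partial>x) F(x,u) + (\<partial>V/\<partial>x') F(x',u')\<close>, with the row vector of partial
  derivatives applied as a linear map.\<close>

definition dissipation_inequality ::
  "'u::euclidean_space set \<Rightarrow> ('x::euclidean_space \<Rightarrow> 'u \<Rightarrow> 'x) \<Rightarrow> ('x \<times> 'x \<Rightarrow> real) \<Rightarrow>
     real \<Rightarrow> (real \<Rightarrow> real) \<Rightarrow> bool" where
  "dissipation_inequality U F V \<kappa> \<sigma> \<longleftrightarrow>
     (\<forall>x x'. \<forall>u\<in>U. \<forall>u'\<in>U.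
        frechet_derivative (\<lambda>w. V (w, x')) (at x) (F x u)
        + frechet_derivative (\<lambda>w. V (x, w)) (at x') (F x' u')
        \<le> - \<kappa> * V (x, x') + \<sigma> (norm (u - u')))"

text \<open>The metric \<open>d\<close> is arbitrary: it need not induce the Euclidean topology.
  Smoothness of \<open>V\<close> is kept apart from these conditions, because for a feedback \<open>\<psi>\<close> that is only
  \<open>C^1\<close> the function \<open>backstepping_Lyapunov\<close> below is in general only \<open>C^1\<close>.\<close>

definition delta_ISS_estimates ::
  "'u::euclidean_space set \<Rightarrow> ('x::euclidean_space \<Rightarrow> 'u \<Rightarrow> 'x) \<Rightarrow> ('x \<times> 'x \<Rightarrow> real) \<Rightarrow> bool" where
  "delta_ISS_estimates U F V \<longleftrightarrow>
     (\<exists>d \<alpha>\<^sub>1 \<alpha>\<^sub>2 \<sigma> \<kappa>.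
        Metric_space UNIV d \<and> K_infinity \<alpha>\<^sub>1 \<and> K_infinity \<alpha>\<^sub>2 \<and> K_infinity \<sigma> \<and> \<kappa> > 0 \<and>
        (\<forall>x x'. \<alpha>\<^sub>1 (d x x') \<le> V (x, x') \<and> V (x, x') \<le> \<alpha>\<^sub>2 (d x x')) \<and>
        dissipation_inequality U F V \<kappa> \<sigma>)"

definition delta_ISS_Lyapunov ::
  "'u::euclidean_space set \<Rightarrow> ('x::euclidean_space \<Rightarrow> 'u \<Rightarrow> 'x) \<Rightarrow> ('x \<times> 'x \<Rightarrow> real) \<Rightarrow> bool" where
  "delta_ISS_Lyapunov U F V \<longleftrightarrow>
     smooth V \<and> (\<forall>p. 0 \<le> V p) \<and> delta_ISS_estimates U F V"

text \<open>The stacked state \<open>[\<eta>\<^sup>T, \<zeta>\<^sup>T]\<^sup>T\<close> is the pair \<open>(\<eta>, \<zeta>)\<close>; the norm of the product type is the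
  Euclidean norm of the stacked vector.\<close>

definition cascade_system ::
  "(real^'n \<Rightarrow> real^'m \<Rightarrow> real^'n) \<Rightarrow> (real^'n) \<times> (real^'m) \<Rightarrow> real^'m \<Rightarrow> (real^'n) \<times> (real^'m)" where
  "cascade_system f x \<upsilon> = (case x of (\<eta>, \<zeta>) \<Rightarrow> (f \<eta> \<zeta>, \<upsilon>))"

definition reduced_system ::
  "(real^'n \<Rightarrow> real^'m \<Rightarrow> real^'n) \<Rightarrow> (real^'n \<Rightarrow> real^'m) \<Rightarrow> real^'n \<Rightarrow> real^'m \<Rightarrow> real^'n" where
  "reduced_system f \<psi> \<eta> u = f \<eta> (\<psi> \<eta> + u)"

definition backstepping_feedback ::
  "(real^'n \<Rightarrow> real^'m \<Rightarrow> real^'n) \<Rightarrow> (real^'n \<Rightarrow> real^'m) \<Rightarrow> real \<Rightarrow>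
     real^'n \<Rightarrow> real^'m \<Rightarrow> real^'m \<Rightarrow> real^'m" where
  "backstepping_feedback f \<psi> l \<eta> \<zeta> v =
     - l *\<^sub>R (\<zeta> - \<psi> \<eta>) + jacobian \<psi> (at \<eta>) *v f \<eta> \<zeta> + v"

definition closed_loop ::
  "(real^'n \<Rightarrow> real^'m \<Rightarrow> real^'n) \<Rightarrow> (real^'n \<Rightarrow> real^'m) \<Rightarrow> real \<Rightarrow>
     (real^'n) \<times> (real^'m) \<Rightarrow> real^'m \<Rightarrow> (real^'n) \<times> (real^'m)" where
  "closed_loop f \<psi> l x v =
     cascade_system f x (backstepping_feedback f \<psi> l (fst x) (snd x) v)"

definition backstepping_Lyapunov ::
  "(real^'n \<Rightarrow> real^'m) \<Rightarrow> ((real^'n) \<times> (real^'n) \<Rightarrow> real) \<Rightarrow>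
     ((real^'n) \<times> (real^'m)) \<times> ((real^'n) \<times> (real^'m)) \<Rightarrow> real" where
  "backstepping_Lyapunov \<psi> V = (\<lambda>((y, z), (y', z')).
     V (y, y') + (norm ((z - \<psi> y) - (z' - \<psi> y')))\<^sup>2)"

end

theory Submission
  imports Defs
begin

text \<open>In the error coordinate \<open>z - \<psi> y\<close> the feedback, through the term
  \<open>jacobian \<psi> (at y) *v f y z\<close>, cancels the drift of \<open>\<psi> y\<close> and leaves the linear dynamics
  \<open>- l *\<^sub>R (z - \<psi> y) + v\<close>. The \<open>y\<close>-component of the closed loop is the reduced system driven by
  this error as input. For two states, let \<open>e\<close> be the difference of the errors, so that the
  candidate function is \<open>V (y, y') + (norm e)\<^sup>2\<close>. Its derivative along the closed loop is at most

  \<open>- \<kappa> * V (y, y') + \<sigma> (norm e) - 2 * l * (norm e)\<^sup>2 + 2 * (e \<bullet> (v - v'))\<close>,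

  where \<open>\<sigma> (norm e) \<le> \<kappa>' * (norm e)\<^sup>2\<close> and, by Young's inequality, the last term is at most
  \<open>(norm e)\<^sup>2 + (norm (v - v'))\<^sup>2\<close>. The hypothesis \<open>2 * l \<ge> \<kappa> + \<kappa>' + 1\<close> suffices to
  absorb \<open>(\<kappa>' + 1) * (norm e)\<^sup>2\<close> and still keep the decay rate \<open>\<kappa>\<close>, with the gain
  \<open>r\<^sup>2\<close> (\<open>backstepping_dissipation_inequality\<close>).

  If \<open>d\<close> is the metric that belongs to \<open>V\<close>, then \<open>d y y' + norm e\<close> is a metric on the stacked
  states, because \<open>(y, z) \<mapsto> (y, z - \<psi> y)\<close> is injective
  (\<open>Metric_space_backstepping\<close>), and it bounds the candidate function from both sides
  (\<open>K_infinity_sum_bounds\<close>). What remains is regularity: sums, bilinear products and precompositions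
  with linear maps preserve class \<open>C^k\<close> (\<open>class_C_backstepping_Lyapunov\<close>), and the Jacobian term
  of the feedback is Lipschitz on compact sets once \<open>\<psi>\<close> is of class \<open>C^2\<close>
  (\<open>closed_loop_control_system\<close>).\<close>

section \<open>Calculus of functions of class C^k\<close>

lemma class_C_Suc_imp_class_C: "class_C (Suc k) g \<Longrightarrow> class_C k g"
proof (induction k arbitrary: g)
  case 0
  then show ?case
    by (simp add: continuous_at_imp_continuous_on differentiable_imp_continuous_within)
next
  case (Suc k)
  then show ?case by simp
qed

lemma class_C_Suc_I:
  assumes "\<And>x. (g has_derivative D x) (at x)"
    and "\<And>v. class_C k (\<lambda>x. D x v)"
  shows "class_C (Suc k) g"
proof -
  have "frechet_derivative g (at x) = D x" for x
    using frechet_derivative_at[OF assms(1)] by simp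
  then show ?thesis
    using assms by (auto intro: differentiableI)
qed

lemma class_C_Suc_has_derivative:
  "class_C (Suc k) g \<Longrightarrow> (g has_derivative frechet_derivative g (at x)) (at x)"
  by (simp flip: frechet_derivative_works)

lemma class_C_const: "class_C k (\<lambda>x. c)"
  by (induction k arbitrary: c) (auto intro!: class_C_Suc_I derivative_eq_intros simp del: class_C.simps(2))

lemma class_C_linear:
  assumes "bounded_linear L"
  shows "class_C k L"
proof (cases k)
  case 0
  then show ?thesis
    using assms by (simp add: linear_continuous_on)
next
  case (Suc j)
  then show ?thesis
    using class_C_Suc_I[of L "\<lambda>_. L" j] assms
    by (auto intro: bounded_linear_imp_has_derivative class_C_const simp del: class_C.simps)
qed

lemma class_C_add:
  "class_C k g \<Longrightarrow> class_C k h \<Longrightarrow> class_C k (\<lambda>x. g x + h x)"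
proof (induction k arbitrary: g h)
  case 0
  then show ?case by (simp add: continuous_on_add)
next
  case (Suc k)
  show ?case
  proof (rule class_C_Suc_I)
    show "((\<lambda>x. g x + h x) has_derivative
        (\<lambda>v. frechet_derivative g (at x) v + frechet_derivative h (at x) v)) (at x)" for x
      by (intro has_derivative_add class_C_Suc_has_derivative[OF Suc.prems(1)]
          class_C_Suc_has_derivative[OF Suc.prems(2)])
    show "class_C k (\<lambda>x. frechet_derivative g (at x) v + frechet_derivative h (at x) v)" for v
      using Suc.prems by (intro Suc.IH) auto
  qed
qed

text \<open>Precomposition with a linear map \<open>L\<close> only evaluates the same derivatives at \<open>L x\<close> in the
  direction \<open>L v\<close>, so no chain rule for two nonlinear maps is involved.\<close>

lemma class_C_compose_linear:
  assumes "bounded_linear L"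
  shows "class_C k g \<Longrightarrow> class_C k (\<lambda>x. g (L x))"
proof (induction k arbitrary: g)
  case 0
  then have "continuous_on (range L) g"
    by (auto intro: continuous_on_subset)
  then show ?case
    using continuous_on_compose2[OF _ linear_continuous_on[OF assms, of UNIV]] by auto
next
  case (Suc k)
  show ?case
  proof (rule class_C_Suc_I)
    show "((\<lambda>x. g (L x)) has_derivative (\<lambda>v. frechet_derivative g (at (L x)) (L v))) (at x)" for x
      using has_derivative_compose[OF bounded_linear_imp_has_derivative[OF assms]
          class_C_Suc_has_derivative[OF Suc.prems]] .
    show "class_C k (\<lambda>x. frechet_derivative g (at (L x)) (L v))" for v
      using Suc.prems by (intro Suc.IH[of "\<lambda>y. frechet_derivative g (at y) (L v)"]) auto
  qed
qed

text \<open>By Leibniz' rule the derivative of a product is a sum of products of functions of class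
  \<open>C^k\<close> when the factors are of class \<open>C^(k+1)\<close>; the factors that are not differentiated
  lose one order here, which is harmless.\<close>

lemma class_C_bilinear:
  fixes prod :: "'b::euclidean_space \<Rightarrow> 'c::euclidean_space \<Rightarrow> 'd::euclidean_space"
  assumes "bounded_bilinear prod"
  shows "class_C k g \<Longrightarrow> class_C k h \<Longrightarrow> class_C k (\<lambda>x. prod (g x) (h x))"
proof (induction k arbitrary: g h)
  case 0
  then show ?case by (simp add: bounded_bilinear.continuous_on[OF assms])
next
  case (Suc k)
  show ?case
  proof (rule class_C_Suc_I)
    show "((\<lambda>x. prod (g x) (h x)) has_derivative
        (\<lambda>v. prod (g x) (frechet_derivative h (at x) v) + prod (frechet_derivative g (at x) v) (h x)))
        (at x)" for x
      by (intro bounded_bilinear.FDERIV[OF assms] class_C_Suc_has_derivative[OF Suc.prems(1)]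
          class_C_Suc_has_derivative[OF Suc.prems(2)])
    show "class_C k (\<lambda>x. prod (g x) (frechet_derivative h (at x) v)
        + prod (frechet_derivative g (at x) v) (h x))" for v
      using Suc.prems Suc.prems[THEN class_C_Suc_imp_class_C]
      by (intro class_C_add Suc.IH) auto
  qed
qed

text \<open>The closure properties above apply once \<open>(norm e)\<^sup>2\<close> is read as the bilinear product
  \<open>e \<bullet> e\<close>, since the norm itself is not differentiable at 0, and \<open>e\<close> as a combination of
  projections and of \<open>\<psi>\<close> precomposed with projections.\<close>

lemma class_C_backstepping_Lyapunov:
  fixes \<psi> :: "real^'n \<Rightarrow> real^'m"
  assumes "class_C k \<psi>" and "class_C k V"
  shows "class_C k (backstepping_Lyapunov \<psi> V)"
proof -
  define e where "e p = (snd (fst p) + - 1 *\<^sub>R snd (snd p)) + - 1 *\<^sub>R \<psi> (fst (fst p)) + \<psi> (fst (snd p))"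
    for p :: "((real^'n) \<times> (real^'m)) \<times> ((real^'n) \<times> (real^'m))"
  have \<psi>: "class_C k (\<lambda>x. \<psi> (L x))" if "bounded_linear L"
    for L :: "((real^'n) \<times> (real^'m)) \<times> ((real^'n) \<times> (real^'m)) \<Rightarrow> real^'n"
    using class_C_compose_linear[OF that assms(1)] .
  have "class_C k e"
    unfolding e_def
    by (intro class_C_add class_C_bilinear[OF bounded_bilinear_scaleR] class_C_const class_C_linear \<psi>
        bounded_linear_intros)
  moreover have "class_C k (\<lambda>p::((real^'n) \<times> (real^'m)) \<times> ((real^'n) \<times> (real^'m)).
      V (fst (fst p), fst (snd p)))"
    by (rule class_C_compose_linear[OF _ assms(2)]) (intro bounded_linear_intros bounded_linear_Pair)
  ultimately have "class_C k (\<lambda>p. V (fst (fst p), fst (snd p)) + e p \<bullet> e p)"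
    by (intro class_C_add class_C_bilinear[OF bounded_bilinear_inner])
  moreover have "backstepping_Lyapunov \<psi> V = (\<lambda>p. V (fst (fst p), fst (snd p)) + e p \<bullet> e p)"
    by (auto simp: backstepping_Lyapunov_def e_def dot_square_norm fun_eq_iff algebra_simps)
  ultimately show ?thesis by simp
qed

section \<open>Lipschitz continuity on compact sets\<close>

text \<open>A ball around the compact set is convex, so the mean value inequality applies there, with a
  bound over the ball for the sum of the norms of the partial derivatives as constant.\<close>

lemma class_C_1_lipschitz_on_compact:
  fixes g :: "'a::euclidean_space \<Rightarrow> 'b::euclidean_space"
  assumes "class_C 1 g" and "compact Q"
  obtains L where "L-lipschitz_on Q g"
proof -
  obtain r where r: "Q \<subseteq> cball 0 r"
    using \<open>compact Q\<close> by (metis compact_imp_bounded bounded_iff mem_cball_0 subsetI)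
  have "continuous_on (cball 0 r) (\<lambda>x. \<Sum>i\<in>Basis. norm (frechet_derivative g (at x) i))"
    using assms(1) by (intro continuous_intros) (auto intro: continuous_on_subset)
  then have "bounded ((\<lambda>x. \<Sum>i\<in>Basis. norm (frechet_derivative g (at x) i)) ` cball 0 r)"
    by (intro compact_imp_bounded compact_continuous_image compact_cball)
  then obtain B where "B > 0"
    and B: "\<And>x. x \<in> cball 0 r \<Longrightarrow> norm (\<Sum>i\<in>Basis. norm (frechet_derivative g (at x) i)) \<le> B"
    by (auto simp: bounded_pos simp del: real_norm_def)
  have der: "(g has_derivative frechet_derivative g (at x)) (at x)" for x
    using assms(1) by (intro class_C_Suc_has_derivative[of 0]) simp
  have "norm (g x - g y) \<le> B * norm (x - y)" if "x \<in> cball 0 r" "y \<in> cball 0 r" for x y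
  proof (rule differentiable_bound[OF convex_cball has_derivative_at_withinI[OF der] _ that])
    show "onorm (frechet_derivative g (at u)) \<le> B" if "u \<in> cball 0 r" for u
      using B[OF that] has_derivative_bounded_linear[OF der]
      by (intro onorm_componentwise_le) auto
  qed
  then have "B-lipschitz_on Q g"
    using subsetD[OF r] \<open>B > 0\<close> by (intro lipschitz_onI) (simp_all add: dist_norm)
  then show thesis by (rule that)
qed

lemma lipschitz_on_scaleR_compact:
  fixes g :: "'a::metric_space \<Rightarrow> real" and h :: "'a \<Rightarrow> 'b::real_normed_vector"
  assumes "compact Q" and g: "L-lipschitz_on Q g" and h: "M-lipschitz_on Q h"
  obtains N where "N-lipschitz_on Q (\<lambda>x. g x *\<^sub>R h x)"
proof -
  have "bounded (g ` Q)" "bounded (h ` Q)"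
    using assms by (auto intro!: compact_imp_bounded compact_continuous_image lipschitz_on_continuous_on)
  then obtain A B where "A > 0" "B > 0"
    and A: "\<And>x. x \<in> Q \<Longrightarrow> norm (g x) \<le> A" and B: "\<And>x. x \<in> Q \<Longrightarrow> norm (h x) \<le> B"
    by (auto simp: bounded_pos simp del: real_norm_def)
  have "(A * M + L * B)-lipschitz_on Q (\<lambda>x. g x *\<^sub>R h x)"
  proof (rule lipschitz_onI)
    show "0 \<le> A * M + L * B"
      using \<open>A > 0\<close> \<open>B > 0\<close> lipschitz_on_nonneg[OF g] lipschitz_on_nonneg[OF h] by simp
    fix x y assume xy: "x \<in> Q" "y \<in> Q"
    have "g x *\<^sub>R h x - g y *\<^sub>R h y = g x *\<^sub>R (h x - h y) + (g x - g y) *\<^sub>R h y"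
      by (simp add: algebra_simps)
    then have "dist (g x *\<^sub>R h x) (g y *\<^sub>R h y) \<le> norm (g x *\<^sub>R (h x - h y)) + norm ((g x - g y) *\<^sub>R h y)"
      by (metis dist_norm norm_triangle_ineq)
    also have "\<dots> = norm (g x) * dist (h x) (h y) + dist (g x) (g y) * norm (h y)"
      by (simp add: dist_norm)
    also have "\<dots> \<le> A * (M * dist x y) + (L * dist x y) * B"
      using A[OF xy(1)] B[OF xy(2)] lipschitz_onD[OF g xy] lipschitz_onD[OF h xy] \<open>A > 0\<close>
        lipschitz_on_nonneg[OF g]
      by (intro add_mono mult_mono) auto
    finally show "dist (g x *\<^sub>R h x) (g y *\<^sub>R h y) \<le> (A * M + L * B) * dist x y"
      by (simp add: algebra_simps)
  qed
  then show thesis by (rule that)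
qed

lemma lipschitz_on_sum:
  fixes g :: "'i \<Rightarrow> 'a::metric_space \<Rightarrow> 'b::real_normed_vector"
  assumes "finite I" and "\<And>i. i \<in> I \<Longrightarrow> \<exists>L. L-lipschitz_on Q (g i)"
  shows "\<exists>L. L-lipschitz_on Q (\<lambda>x. \<Sum>i\<in>I. g i x)"
  using assms
proof (induction rule: finite_induct)
  case empty
  show ?case using lipschitz_on_constant[of Q 0] by auto
next
  case (insert i I)
  obtain L where "L-lipschitz_on Q (g i)"
    using insert.prems by blast
  moreover obtain M where "M-lipschitz_on Q (\<lambda>x. \<Sum>j\<in>I. g j x)"
    using insert.IH insert.prems by blast
  ultimately have "(L + M)-lipschitz_on Q (\<lambda>x. g i x + (\<Sum>j\<in>I. g j x))"
    by (rule lipschitz_on_add)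
  then show ?case using insert.hyps by auto
qed

section \<open>The closed loop is a control system\<close>

lemma jacobian_mult_eq_frechet_derivative:
  fixes \<psi> :: "real^'n \<Rightarrow> real^'m"
  assumes "\<psi> differentiable (at x)"
  shows "jacobian \<psi> (at x) *v h = frechet_derivative \<psi> (at x) h"
  using frechet_derivative_at[OF jacobian_works[THEN iffD1, OF assms]] by metis

lemma cascade_control_systemD:
  fixes f :: "real^'n \<Rightarrow> real^'m \<Rightarrow> real^'n"
  assumes "control_system UNIV (cascade_system f)"
  shows "continuous_on UNIV (\<lambda>x. f (fst x) (snd x))"
    and "compact Q \<Longrightarrow> \<exists>L. L-lipschitz_on Q (\<lambda>x. f (fst x) (snd x))"
proof -
  have "continuous_on (UNIV \<times> UNIV) (\<lambda>(x, u). cascade_system f x u)"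
    using assms by (simp add: control_system_def)
  then have "continuous_on UNIV (\<lambda>x. case (x, 0) of (x, u) \<Rightarrow> cascade_system f x u)"
    by (rule continuous_on_compose2) (auto intro!: continuous_intros)
  then have "continuous_on UNIV (\<lambda>x. fst (cascade_system f x 0))"
    by (auto intro: continuous_on_fst)
  then show "continuous_on UNIV (\<lambda>x. f (fst x) (snd x))"
    by (simp add: cascade_system_def case_prod_beta)
  show "\<exists>L. L-lipschitz_on Q (\<lambda>x. f (fst x) (snd x))" if "compact Q"
  proof -
    obtain Z where "Z > 0"
      and Z: "\<And>x y. x \<in> Q \<Longrightarrow> y \<in> Q \<Longrightarrow>
          norm (cascade_system f x 0 - cascade_system f y 0) \<le> Z * norm (x - y)"
      using assms[unfolded control_system_def, THEN conjunct2, rule_format, OF \<open>compact Q\<close>]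
      by (metis UNIV_I)
    have "norm (f (fst x) (snd x) - f (fst y) (snd y)) \<le> norm (cascade_system f x 0 - cascade_system f y 0)"
      for x y
      by (simp add: cascade_system_def case_prod_beta norm_Pair)
    then have "Z-lipschitz_on Q (\<lambda>x. f (fst x) (snd x))"
      using Z \<open>Z > 0\<close> unfolding lipschitz_on_def dist_norm
      by (meson order_trans order_less_imp_le)
    then show ?thesis by blast
  qed
qed

text \<open>The Jacobian term is expanded into partial derivatives of \<open>\<psi>\<close>, each multiplied by a
  component of \<open>f\<close>: a product of functions that are Lipschitz, hence bounded, on compact sets.
  The partial derivatives of \<open>\<psi>\<close> are so because \<open>\<psi>\<close> is of class \<open>C^2\<close>. The input
  enters additively, so it cancels in differences and the constant is uniform in it.\<close>

lemma closed_loop_control_system: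
  fixes f :: "real^'n \<Rightarrow> real^'m \<Rightarrow> real^'n" and \<psi> :: "real^'n \<Rightarrow> real^'m"
  assumes f: "control_system UNIV (cascade_system f)" and \<psi>: "class_C 2 \<psi>"
  shows "control_system UNIV (closed_loop f \<psi> l)"
proof -
  let ?f = "\<lambda>x. f (fst x) (snd x)"
  let ?D = "\<lambda>i y. frechet_derivative \<psi> (at y) i"
  have \<psi>1: "class_C 1 \<psi>"
    using \<psi> class_C_Suc_imp_class_C[of 1 \<psi>] by (simp add: numeral_2_eq_2 del: class_C.simps)
  have D1: "class_C 1 (?D i)" for i
    using \<psi> by (simp add: numeral_2_eq_2)
  have der: "(\<psi> has_derivative frechet_derivative \<psi> (at y)) (at y)" for y
    using \<psi>1 by (intro class_C_Suc_has_derivative[of 0]) simp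
  define G where "G x = - l *\<^sub>R (snd x - \<psi> (fst x)) + (\<Sum>i\<in>Basis. (?f x \<bullet> i) *\<^sub>R ?D i (fst x))"
    for x :: "(real^'n) \<times> (real^'m)"
  have loop: "closed_loop f \<psi> l x v = (?f x, G x + v)" for x v
  proof -
    have "jacobian \<psi> (at (fst x)) *v ?f x = frechet_derivative \<psi> (at (fst x)) (\<Sum>i\<in>Basis. (?f x \<bullet> i) *\<^sub>R i)"
      using jacobian_mult_eq_frechet_derivative[OF differentiableI[OF der]]
      by (simp add: euclidean_representation)
    also have "\<dots> = (\<Sum>i\<in>Basis. (?f x \<bullet> i) *\<^sub>R ?D i (fst x))"
      using has_derivative_linear[OF der] by (simp add: linear_sum linear_scale)
    finally show ?thesis
      by (simp add: closed_loop_def cascade_system_def backstepping_feedback_def G_def case_prod_beta)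
  qed
  have C0: "continuous_on UNIV g" if "class_C 1 g"
    for g :: "real^'n \<Rightarrow> real^'m"
    using class_C_Suc_imp_class_C[of 0 g] that by simp
  have "continuous_on UNIV (\<lambda>x. g (fst x))" if "class_C 1 g"
    for g :: "real^'n \<Rightarrow> real^'m"
    by (rule continuous_on_compose2[OF C0[OF that]]) (auto intro: continuous_intros)
  then have "continuous_on UNIV G"
    unfolding G_def using cascade_control_systemD(1)[OF f] \<psi>1 D1
    by (intro continuous_intros) auto
  then have "continuous_on UNIV (\<lambda>p. (?f (fst p), G (fst p) + snd p))"
    using cascade_control_systemD(1)[OF f]
    by (intro continuous_on_Pair continuous_on_add continuous_on_snd continuous_on_id
        continuous_on_compose2[of UNIV ?f UNIV fst] continuous_on_compose2[of UNIV G UNIV fst]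
        continuous_on_fst) auto
  then have cont: "continuous_on (UNIV \<times> UNIV) (\<lambda>(x, v). closed_loop f \<psi> l x v)"
    by (simp add: loop case_prod_beta)
  have lip: "\<exists>Z>0. \<forall>x\<in>Q. \<forall>y\<in>Q. \<forall>v\<in>UNIV.
      norm (closed_loop f \<psi> l x v - closed_loop f \<psi> l y v) \<le> Z * norm (x - y)"
    if Q: "compact Q" for Q
  proof -
    obtain A where A: "A-lipschitz_on Q ?f"
      using cascade_control_systemD(2)[OF f Q] by blast
    have fstQ: "\<exists>L. L-lipschitz_on Q (\<lambda>x. g (fst x))" if "class_C 1 g" for g :: "real^'n \<Rightarrow> real^'m"
    proof -
      have "compact (fst ` Q)"
        using Q by (intro compact_continuous_image continuous_intros)
      then obtain L where "L-lipschitz_on (fst ` Q) g"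
        using class_C_1_lipschitz_on_compact[OF \<open>class_C 1 g\<close>] by metis
      moreover have "1-lipschitz_on Q fst"
        by (intro lipschitz_onI) (auto simp: dist_fst_le)
      ultimately show ?thesis
        using lipschitz_on_compose2 by blast
    qed
    obtain B where B: "B-lipschitz_on Q (\<lambda>x. \<psi> (fst x))"
      using fstQ[OF \<psi>1] by blast
    have "1-lipschitz_on Q snd"
      by (intro lipschitz_onI) (auto simp: dist_snd_le)
    then have "(\<bar>- l\<bar> * (1 + B))-lipschitz_on Q (\<lambda>x. - l *\<^sub>R (snd x - \<psi> (fst x)))"
      using B by (intro lipschitz_on_cmult lipschitz_on_diff)
    moreover obtain M where "M-lipschitz_on Q (\<lambda>x. \<Sum>i\<in>Basis. (?f x \<bullet> i) *\<^sub>R ?D i (fst x))"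
    proof (atomize_elim, rule lipschitz_on_sum[OF finite_Basis])
      fix i :: "real^'n" assume i: "i \<in> Basis"
      have "A-lipschitz_on Q (\<lambda>x. ?f x \<bullet> i)"
      proof (rule lipschitz_onI)
        fix x y assume "x \<in> Q" "y \<in> Q"
        have "dist (?f x \<bullet> i) (?f y \<bullet> i) \<le> dist (?f x) (?f y)"
          using Basis_le_norm[OF i, of "?f x - ?f y"] by (simp add: dist_norm inner_diff_left)
        then show "dist (?f x \<bullet> i) (?f y \<bullet> i) \<le> A * dist x y"
          using lipschitz_onD[OF A \<open>x \<in> Q\<close> \<open>y \<in> Q\<close>] by simp
      qed (rule lipschitz_on_nonneg[OF A])
      moreover obtain L where "L-lipschitz_on Q (\<lambda>x. ?D i (fst x))"
        using fstQ[OF D1] by blast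
      ultimately obtain N where "N-lipschitz_on Q (\<lambda>x. (?f x \<bullet> i) *\<^sub>R ?D i (fst x))"
        by (rule lipschitz_on_scaleR_compact[OF Q])
      then show "\<exists>L. L-lipschitz_on Q (\<lambda>x. (?f x \<bullet> i) *\<^sub>R ?D i (fst x))" ..
    qed
    ultimately have "(\<bar>- l\<bar> * (1 + B) + M)-lipschitz_on Q G"
      unfolding G_def by (rule lipschitz_on_add)
    from lipschitz_on_Pair[OF A this]
    obtain Z where Z: "Z-lipschitz_on Q (\<lambda>x. (?f x, G x))" ..
    have "norm (closed_loop f \<psi> l x v - closed_loop f \<psi> l y v) \<le> (Z + 1) * norm (x - y)"
      if "x \<in> Q" "y \<in> Q" for x y v
      using lipschitz_onD[OF Z that] by (simp add: loop dist_norm distrib_right add_increasing2)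
    then show ?thesis
      using lipschitz_on_nonneg[OF Z] by (intro exI[of _ "Z + 1"]) auto
  qed
  show ?thesis
    unfolding control_system_def using cont lip by blast
qed

section \<open>Comparison functions\<close>

lemma K_infinity_mono: "K_infinity \<gamma> \<Longrightarrow> 0 \<le> r \<Longrightarrow> r \<le> s \<Longrightarrow> \<gamma> r \<le> \<gamma> s"
  by (auto simp: K_infinity_def intro: strict_mono_on_leD)

lemma K_infinity_nonneg: "K_infinity \<gamma> \<Longrightarrow> 0 \<le> r \<Longrightarrow> 0 \<le> \<gamma> r"
  using K_infinity_mono[of \<gamma> 0 r] by (simp add: K_infinity_def)

lemma K_infinity_power2: "K_infinity (\<lambda>r. r\<^sup>2)"
proof -
  have "continuous_on {0..} (\<lambda>r::real. r\<^sup>2)"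
    by (intro continuous_intros)
  moreover have "strict_mono_on {0..} (\<lambda>r::real. r\<^sup>2)"
    by (intro strict_mono_onI power_strict_mono) auto
  moreover have "filterlim (\<lambda>r::real. r\<^sup>2) at_top at_top"
    by (intro filterlim_pow_at_top filterlim_ident) simp
  ultimately show ?thesis
    by (simp add: K_infinity_def)
qed

lemma K_infinity_half:
  assumes "K_infinity \<gamma>"
  shows "K_infinity (\<lambda>r. \<gamma> (r / 2))"
proof -
  have "continuous_on {0..} (\<lambda>r. \<gamma> (r / 2))"
    using assms unfolding K_infinity_def
    by (intro continuous_on_compose2[of "{0..}" \<gamma> _ "\<lambda>r. r / 2"] continuous_intros) auto
  moreover have "strict_mono_on {0..} (\<lambda>r. \<gamma> (r / 2))"
    using assms by (auto simp: K_infinity_def strict_mono_on_def)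
  moreover have "filterlim (\<lambda>r::real. r / 2) at_top at_top"
    using filterlim_tendsto_pos_mult_at_top[OF tendsto_const, of "1/2::real" "\<lambda>r. r" at_top]
    by (simp add: filterlim_ident)
  then have "filterlim (\<lambda>r. \<gamma> (r / 2)) at_top at_top"
    using assms by (auto simp: K_infinity_def intro: filterlim_compose)
  ultimately show ?thesis
    using assms by (simp add: K_infinity_def)
qed

lemma K_infinity_add:
  assumes "K_infinity \<beta>" "K_infinity \<gamma>"
  shows "K_infinity (\<lambda>r. \<beta> r + \<gamma> r)"
proof -
  have "continuous_on {0..} (\<lambda>r. \<beta> r + \<gamma> r)"
    using assms unfolding K_infinity_def by (intro continuous_intros) simp_all
  moreover have "strict_mono_on {0..} (\<lambda>r. \<beta> r + \<gamma> r)"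
    using assms by (simp add: K_infinity_def strict_mono_on_def add_strict_mono)
  moreover have "filterlim (\<lambda>r. \<beta> r + \<gamma> r) at_top at_top"
    using assms unfolding K_infinity_def by (intro filterlim_at_top_add_at_top) simp_all
  ultimately show ?thesis
    using assms by (simp add: K_infinity_def)
qed

lemma K_infinity_min:
  assumes "K_infinity \<beta>" "K_infinity \<gamma>"
  shows "K_infinity (\<lambda>r. min (\<beta> r) (\<gamma> r))"
proof -
  have "continuous_on {0..} (\<lambda>r. min (\<beta> r) (\<gamma> r))"
    using assms unfolding K_infinity_def by (intro continuous_on_min) simp_all
  moreover have "strict_mono_on {0..} (\<lambda>r. min (\<beta> r) (\<gamma> r))"
    using assms by (simp add: K_infinity_def strict_mono_on_def min_less_iff_disj)
  moreover have "filterlim (\<lambda>r. min (\<beta> r) (\<gamma> r)) at_top at_top"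
    using assms by (simp add: K_infinity_def filterlim_at_top eventually_conj_iff)
  ultimately show ?thesis
    using assms by (simp add: K_infinity_def)
qed

section \<open>The comparison metric\<close>

text \<open>The metric is the pullback of the sum of \<open>d\<close> and the norm distance under the injective change
  of coordinates \<open>(y, z) \<mapsto> (y, z - \<psi> y)\<close>.\<close>

lemma Metric_space_backstepping:
  fixes d :: "'y \<Rightarrow> 'y \<Rightarrow> real" and \<psi> :: "'y \<Rightarrow> 'z::real_normed_vector"
  assumes "Metric_space UNIV d"
  shows "Metric_space UNIV
    (\<lambda>x x'. d (fst x) (fst x') + norm ((snd x - \<psi> (fst x)) - (snd x' - \<psi> (fst x'))))"
    (is "Metric_space UNIV ?d")
proof -
  interpret d: Metric_space UNIV d by fact
  show ?thesis
  proof
    show "?d x x' = ?d x' x" for x x'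
      by (simp add: d.commute norm_minus_commute)
    show "?d x x' = 0 \<longleftrightarrow> x = x'" for x x'
      by (auto simp: add_nonneg_eq_0_iff prod_eq_iff)
    show "?d x x'' \<le> ?d x x' + ?d x' x''" for x x' x''
      using d.triangle[of "fst x" "fst x'" "fst x''"]
        dist_triangle[of "snd x - \<psi> (fst x)" "snd x'' - \<psi> (fst x'')" "snd x' - \<psi> (fst x')"]
      by (simp add: dist_norm)
  qed simp
qed

text \<open>Of two nonnegative numbers with sum \<open>s\<close>, one is at least \<open>s / 2\<close>: this is where the
  lower comparison function comes from. The upper one works because both \<open>d\<close> and \<open>r\<close> are at
  most \<open>d + r\<close>.\<close>

lemma K_infinity_sum_bounds:
  assumes "K_infinity \<alpha>\<^sub>1" "K_infinity \<alpha>\<^sub>2" and "0 \<le> d" "0 \<le> r" and "\<alpha>\<^sub>1 d \<le> v" "v \<le> \<alpha>\<^sub>2 d"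
  shows "min (\<alpha>\<^sub>1 ((d + r) / 2)) (((d + r) / 2)\<^sup>2) \<le> v + r\<^sup>2"
    and "v + r\<^sup>2 \<le> \<alpha>\<^sub>2 (d + r) + (d + r)\<^sup>2"
proof -
  show "min (\<alpha>\<^sub>1 ((d + r) / 2)) (((d + r) / 2)\<^sup>2) \<le> v + r\<^sup>2"
  proof (cases "r \<le> d")
    case True
    then have "\<alpha>\<^sub>1 ((d + r) / 2) \<le> \<alpha>\<^sub>1 d"
      using assms by (intro K_infinity_mono[OF assms(1)]) auto
    then show ?thesis
      using assms(5) zero_le_power2[of r] by linarith
  next
    case False
    then have "((d + r) / 2)\<^sup>2 \<le> r\<^sup>2"
      using assms by (intro power_mono) auto
    moreover have "0 \<le> v"
      using K_infinity_nonneg[OF assms(1,3)] assms(5) by linarith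
    ultimately show ?thesis by linarith
  qed
  have "\<alpha>\<^sub>2 d \<le> \<alpha>\<^sub>2 (d + r)" "r\<^sup>2 \<le> (d + r)\<^sup>2"
    using assms by (auto intro: K_infinity_mono[OF assms(2)] power_mono)
  then show "v + r\<^sup>2 \<le> \<alpha>\<^sub>2 (d + r) + (d + r)\<^sup>2"
    using assms(6) by linarith
qed

section \<open>The dissipation inequality\<close>

text \<open>The dissipation inequality asks for the partial derivatives in the two states separately. In both
  of them \<open>snd h - \<psi>' (fst h)\<close> is the derivative of the error \<open>z - \<psi> y\<close> in the direction
  \<open>h\<close>.\<close>

lemma backstepping_Lyapunov_has_derivative_left:
  assumes "(\<psi> has_derivative \<psi>') (at (fst x))"
    and "((\<lambda>w. V (w, fst x')) has_derivative A) (at (fst x))"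
  shows "((\<lambda>w. backstepping_Lyapunov \<psi> V (w, x')) has_derivative
    (\<lambda>h. A (fst h) + 2 * (((snd x - \<psi> (fst x)) - (snd x' - \<psi> (fst x'))) \<bullet> (snd h - \<psi>' (fst h))))) (at x)"
proof -
  have f: "(fst has_derivative fst) (at x)" by (intro derivative_intros)
  note V = has_derivative_compose[OF f assms(2)]
  note P = has_derivative_compose[OF f assms(1)]
  show ?thesis
    unfolding backstepping_Lyapunov_def case_prod_beta fst_conv snd_conv power2_norm_eq_inner
    by (rule has_derivative_eq_rhs, rule has_derivative_add[OF V]) 
       (auto intro!: derivative_eq_intros P simp: inner_commute fun_eq_iff)
qed

lemma backstepping_Lyapunov_has_derivative_right:
  assumes "(\<psi> has_derivative \<psi>') (at (fst x'))"
    and "((\<lambda>w. V (fst x, w)) has_derivative A) (at (fst x'))"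
  shows "((\<lambda>w. backstepping_Lyapunov \<psi> V (x, w)) has_derivative
    (\<lambda>h. A (fst h) - 2 * (((snd x - \<psi> (fst x)) - (snd x' - \<psi> (fst x'))) \<bullet> (snd h - \<psi>' (fst h))))) (at x')"
proof -
  have f: "(fst has_derivative fst) (at x')" by (intro derivative_intros)
  note V = has_derivative_compose[OF f assms(2)]
  note P = has_derivative_compose[OF f assms(1)]
  show ?thesis
    unfolding backstepping_Lyapunov_def case_prod_beta fst_conv snd_conv power2_norm_eq_inner
    by (rule has_derivative_eq_rhs, rule has_derivative_add[OF V]) 
       (auto intro!: derivative_eq_intros P simp: inner_commute fun_eq_iff algebra_simps)
qed

text \<open>The error terms of the two states combine to
  \<open>2 * (e \<bullet> (- l *\<^sub>R e + v - v'))\<close>; Young's inequality for \<open>e \<bullet> (v - v')\<close> costs the summand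
  \<open>1\<close> in the bound on \<open>l\<close>, the gain \<open>\<sigma>\<close> of the reduced system costs \<open>\<kappa>'\<close>, and the
  summand \<open>\<kappa>\<close> gives the decay of \<open>(norm e)\<^sup>2\<close> itself.\<close>

lemma backstepping_dissipation_inequality:
  fixes f :: "real^'n \<Rightarrow> real^'m \<Rightarrow> real^'n" and \<psi> :: "real^'n \<Rightarrow> real^'m"
  assumes \<psi>: "\<And>y. \<psi> differentiable (at y)" and V: "\<And>p. V differentiable (at p)"
    and dis: "dissipation_inequality UNIV (reduced_system f \<psi>) V \<kappa> \<sigma>"
    and \<sigma>: "\<And>r. r \<ge> 0 \<Longrightarrow> \<sigma> r \<le> \<kappa>' * r\<^sup>2"
    and l: "l \<ge> (\<kappa> + \<kappa>' + 1) / 2"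
  shows "dissipation_inequality UNIV (closed_loop f \<psi> l) (backstepping_Lyapunov \<psi> V) \<kappa> (\<lambda>r. r\<^sup>2)"
  unfolding dissipation_inequality_def
proof (intro allI ballI)
  fix x x' :: "(real^'n) \<times> (real^'m)" and v v' :: "real^'m"
  obtain y z y' z' where x: "x = (y, z)" and x': "x' = (y', z')"
    by (metis surj_pair)
  let ?F = "closed_loop f \<psi> l"
  let ?A = "frechet_derivative (\<lambda>w. V (w, y')) (at y)"
  let ?A' = "frechet_derivative (\<lambda>w. V (y, w)) (at y')"
  define e where "e = (z - \<psi> y) - (z' - \<psi> y')"
  have d\<psi>: "(\<psi> has_derivative (*v) (jacobian \<psi> (at y))) (at y)" for y
    using \<psi> jacobian_works by blast
  have "(\<lambda>w. V (w, y')) differentiable (at y)"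
    by (rule differentiable_compose[OF V]) (auto simp: differentiable_def intro!: exI derivative_intros)
  then have A: "((\<lambda>w. V (w, y')) has_derivative ?A) (at y)"
    by (simp flip: frechet_derivative_works)
  have "(\<lambda>w. V (y, w)) differentiable (at y')"
    by (rule differentiable_compose[OF V]) (auto simp: differentiable_def intro!: exI derivative_intros)
  then have A': "((\<lambda>w. V (y, w)) has_derivative ?A') (at y')"
    by (simp flip: frechet_derivative_works)
  have fst_F: "fst (?F (y, z) v) = f y z" for y z v
    by (simp add: closed_loop_def cascade_system_def)
  \<comment> \<open>the velocity of the error: the Jacobian term of the feedback cancels\<close>
  have shift: "snd (?F (y, z) v) - jacobian \<psi> (at y) *v fst (?F (y, z) v) = - l *\<^sub>R (z - \<psi> y) + v"
    for y z v
    by (simp add: closed_loop_def cascade_system_def backstepping_feedback_def)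
  have "frechet_derivative (\<lambda>w. backstepping_Lyapunov \<psi> V (w, x')) (at x) (?F x v)
      = ?A (f y z) + 2 * (e \<bullet> (- l *\<^sub>R (z - \<psi> y) + v))"
    using backstepping_Lyapunov_has_derivative_left[of \<psi> _ x V x' ?A, THEN frechet_derivative_at, symmetric,
        of "(*v) (jacobian \<psi> (at y))"] d\<psi> A shift[of y z v] fst_F[of y z v]
    by (simp add: x x' e_def)
  moreover have "frechet_derivative (\<lambda>w. backstepping_Lyapunov \<psi> V (x, w)) (at x') (?F x' v')
      = ?A' (f y' z') - 2 * (e \<bullet> (- l *\<^sub>R (z' - \<psi> y') + v'))"
    using backstepping_Lyapunov_has_derivative_right[of \<psi> _ x' V x ?A', THEN frechet_derivative_at, symmetric,
        of "(*v) (jacobian \<psi> (at y'))"] d\<psi> A' shift[of y' z' v'] fst_F[of y' z' v']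
    by (simp add: x x' e_def)
  moreover have "2 * (e \<bullet> (- l *\<^sub>R (z - \<psi> y) + v)) - 2 * (e \<bullet> (- l *\<^sub>R (z' - \<psi> y') + v'))
      = - 2 * l * (norm e)\<^sup>2 + 2 * (e \<bullet> (v - v'))"
    by (simp add: e_def power2_norm_eq_inner algebra_simps inner_commute)
  \<comment> \<open>the subsystem sees the input \<open>z - \<psi> y\<close>, because \<open>f y z = reduced_system f \<psi> y (z - \<psi> y)\<close>\<close>
  moreover have "?A (f y z) + ?A' (f y' z') \<le> - \<kappa> * V (y, y') + \<sigma> (norm e)"
    using dis[unfolded dissipation_inequality_def, rule_format, of "z - \<psi> y" "z' - \<psi> y'" y' y]
    by (simp add: reduced_system_def e_def)
  moreover have "\<sigma> (norm e) \<le> \<kappa>' * (norm e)\<^sup>2"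
    by (simp add: \<sigma>)
  moreover have "2 * (e \<bullet> (v - v')) \<le> (norm e)\<^sup>2 + (norm (v - v'))\<^sup>2"
  proof -
    have "0 \<le> (norm (e - (v - v')))\<^sup>2" by simp
    then show ?thesis
      unfolding power2_norm_eq_inner inner_diff_left[of e] inner_diff_right[of _ e]
      by (simp add: inner_commute)
  qed
  moreover have "(\<kappa> + \<kappa>' + 1) * (norm e)\<^sup>2 \<le> 2 * l * (norm e)\<^sup>2"
    using l by (intro mult_right_mono) auto
  moreover have "backstepping_Lyapunov \<psi> V (x, x') = V (y, y') + (norm e)\<^sup>2"
    by (simp add: backstepping_Lyapunov_def x x' e_def)
  ultimately show "frechet_derivative (\<lambda>w. backstepping_Lyapunov \<psi> V (w, x')) (at x) (?F x v)
      + frechet_derivative (\<lambda>w. backstepping_Lyapunov \<psi> V (x, w)) (at x') (?F x' v')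
      \<le> - \<kappa> * backstepping_Lyapunov \<psi> V (x, x') + (norm (v - v'))\<^sup>2"
    by (simp add: algebra_simps)
qed

lemma backstepping_delta_ISS_estimates:
  fixes f :: "real^'n \<Rightarrow> real^'m \<Rightarrow> real^'n" and \<psi> :: "real^'n \<Rightarrow> real^'m"
  assumes V: "delta_ISS_estimates UNIV (reduced_system f \<psi>) V" and "\<kappa> > 0"
    and dis: "dissipation_inequality UNIV (closed_loop f \<psi> l) (backstepping_Lyapunov \<psi> V) \<kappa> (\<lambda>r. r\<^sup>2)"
  shows "delta_ISS_estimates UNIV (closed_loop f \<psi> l) (backstepping_Lyapunov \<psi> V)"
proof -
  obtain d \<alpha>\<^sub>1 \<alpha>\<^sub>2 where d: "Metric_space UNIV d" and \<alpha>: "K_infinity \<alpha>\<^sub>1" "K_infinity \<alpha>\<^sub>2"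
    and b: "\<And>y y'. \<alpha>\<^sub>1 (d y y') \<le> V (y, y')" "\<And>y y'. V (y, y') \<le> \<alpha>\<^sub>2 (d y y')"
    using V by (auto simp: delta_ISS_estimates_def)
  define D where "D x x' = d (fst x) (fst x') + norm ((snd x - \<psi> (fst x)) - (snd x' - \<psi> (fst x')))"
    for x x'
  have "Metric_space UNIV D"
    using Metric_space_backstepping[OF d, of \<psi>] by (simp add: D_def[abs_def])
  moreover have "min (\<alpha>\<^sub>1 (D x x' / 2)) ((D x x' / 2)\<^sup>2) \<le> backstepping_Lyapunov \<psi> V (x, x')"
    and "backstepping_Lyapunov \<psi> V (x, x') \<le> \<alpha>\<^sub>2 (D x x') + (D x x')\<^sup>2" for x x'
    using K_infinity_sum_bounds[OF \<alpha> Metric_space.nonneg[OF d] norm_ge_zero b]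
    by (simp_all add: D_def backstepping_Lyapunov_def case_prod_beta)
  moreover have "K_infinity (\<lambda>s. min (\<alpha>\<^sub>1 (s / 2)) ((s / 2)\<^sup>2))"
    by (intro K_infinity_min K_infinity_half \<alpha> K_infinity_half[OF K_infinity_power2])
  moreover have "K_infinity (\<lambda>s. \<alpha>\<^sub>2 s + s\<^sup>2)"
    by (intro K_infinity_add \<alpha> K_infinity_power2)
  ultimately show ?thesis
    unfolding delta_ISS_estimates_def using K_infinity_power2 \<open>\<kappa> > 0\<close> dis
    by (intro exI[of _ D] exI[of _ "\<lambda>s. min (\<alpha>\<^sub>1 (s / 2)) ((s / 2)\<^sup>2)"] exI[of _ "\<lambda>s. \<alpha>\<^sub>2 s + s\<^sup>2"]
        exI[of _ "\<lambda>r. r\<^sup>2"] exI[of _ \<kappa>]) blast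
qed

theorem lemma4p5:
  fixes f :: "real^'n \<Rightarrow> real^'m \<Rightarrow> real^'n"
    and \<psi> :: "real^'n \<Rightarrow> real^'m"
    and V :: "(real^'n) \<times> (real^'n) \<Rightarrow> real"
    and \<kappa> \<kappa>' l :: real
    and \<sigma> :: "real \<Rightarrow> real"
  assumes "control_system UNIV (cascade_system f)"
    and "class_C 1 \<psi>"
    and "control_system UNIV (reduced_system f \<psi>)"
    and "delta_ISS_Lyapunov UNIV (reduced_system f \<psi>) V"
    and "\<kappa> > 0" and "K_infinity \<sigma>"
    and "dissipation_inequality UNIV (reduced_system f \<psi>) V \<kappa> \<sigma>"
    and "\<kappa>' > 0" and "\<And>r. r \<ge> 0 \<Longrightarrow> \<sigma> r \<le> \<kappa>' * r\<^sup>2"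
    and "l \<ge> (\<kappa> + \<kappa>' + 1) / 2"
  shows "class_C 1 (backstepping_Lyapunov \<psi> V)
    \<and> (\<forall>p. 0 \<le> backstepping_Lyapunov \<psi> V p)
    \<and> delta_ISS_estimates UNIV (closed_loop f \<psi> l) (backstepping_Lyapunov \<psi> V)
    \<and> (smooth \<psi> \<longrightarrow>
         control_system UNIV (closed_loop f \<psi> l) \<and>
         delta_ISS_Lyapunov UNIV (closed_loop f \<psi> l) (backstepping_Lyapunov \<psi> V))"
proof -
  let ?W = "backstepping_Lyapunov \<psi> V"
  have V: "class_C k V" for k
    using assms(4) by (simp add: delta_ISS_Lyapunov_def smooth_def)
  have V0: "0 \<le> V p" for p
    using assms(4) unfolding delta_ISS_Lyapunov_def by blast
  have W0: "0 \<le> ?W p" for p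
    using V0 by (auto simp: backstepping_Lyapunov_def case_prod_beta)
  have "\<psi> differentiable (at y)" and "V differentiable (at p)" for y p
    using class_C_Suc_has_derivative[of 0] assms(2) V[of "Suc 0"]
    by (auto intro!: differentiableI simp del: class_C.simps)
  then have "dissipation_inequality UNIV (closed_loop f \<psi> l) ?W \<kappa> (\<lambda>r. r\<^sup>2)"
    using assms(7,9,10) by (rule backstepping_dissipation_inequality)
  then have est: "delta_ISS_estimates UNIV (closed_loop f \<psi> l) ?W"
    using assms(4,5) by (auto simp: delta_ISS_Lyapunov_def intro: backstepping_delta_ISS_estimates)
  have "control_system UNIV (closed_loop f \<psi> l)" "smooth ?W" if "smooth \<psi>"
    using that unfolding smooth_def
    by (blast intro: closed_loop_control_system[OF assms(1)] class_C_backstepping_Lyapunov[OF _ V])+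
  then show ?thesis
    using class_C_backstepping_Lyapunov[OF assms(2) V] W0 est
    by (auto simp: delta_ISS_Lyapunov_def)
qed

end
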